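(* Suppose $\ker\begin{bmatrix}X_-R_-^\top\\ U_-R_-^\top\end{bmatrix}^\top=\{0\}$, let $\sigma_{(U_-,X)}^1,\dots,\sigma_{(U_-,X)}^L\in\mathbb{R}^{n\times(n+m)}$ be the vertices of the convex polytope $\Sigma_{(U_-,X)}^R$, and let $\gamma>0$. The data $(U_-,X)$ are informative for common $\mathcal{H}_2$ control with performance $\gamma$ if and only if there exist $K\in\mathbb{R}^{m\times n}$, $P\in\mathbb{R}^{n\times n}$ and $Z\in\mathbb{R}^{p\times p}$ such that $\operatorname{trace}Z<\gamma$ and for all $i\in\{1,\dots,L\}$: $$\begin{bmatrix}P&0&C^\top\\ 0&I&D^\top\\ C&D&Z\end{bmatrix}\succ0\quad\text{and}\quad\begin{bmatrix}P&P\sigma_{(U_-,X)}^i\begin{bmatrix}I\\ K\end{bmatrix}&P\\ \star&P&0\\ \star&\star&\gamma I\end{bmatrix}\succ0.$$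
   Context: Let $n,m,M,N,p\ge 1$ be integers. State data $x(0),\dots,x(N)\in\mathbb{R}^n$ and input data $u(0),\dots,u(N-1)\in\mathbb{R}^m$ are collected in $X=[x(0)\ \cdots\ x(N)]$, $X_+=[x(1)\ \cdots\ x(N)]$, $X_-=[x(0)\ \cdots\ x(N-1)]$, $U_-=[u(0)\ \cdots\ u(N-1)]$. An instrumental signal matrix $R_-\in\mathbb{R}^{M\times N}$ and bounds $C_l,C_u\in\mathbb{R}^{n\times M}$ are given. Inequalities $\le$ between matrices are entry-wise; $\succ0$ means symmetric positive definite, and $\star$ denotes blocks determined by symmetry. The data are generated by a true system $(A_0,B_0)$, i.e. $X_+=A_0X_-+B_0U_-+E_-^0$ for some unknown $E_-^0\in\mathcal{E}_R:=\{E\in\mathbb{R}^{n\times N}\mid C_l\le\tfrac{1}{\sqrt N}ER_-^\top\le C_u\}$. The (hence non-empty) set of feasible systems is $$\Sigma_{(U_-,X)}^R:=\{(A,B)\in\mathbb{R}^{n\times n}\times\mathbb{R}^{n\times m}\mid \exists E_-\in\mathcal{E}_R:\ X_+=AX_-+BU_-+E_-\}.$$ A pair $(A,B)$ is identified with $[A\ \ B]\in\mathbb{R}^{n\times(n+m)}$. Under the kernel condition of the claim, $\Sigma_{(U_-,X)}^R$ is a bounded polyhedron, so it is the convex hull of its finitely many vertices $\sigma_{(U_-,X)}^1,\dots,\sigma_{(U_-,X)}^L$. User-specified performance matrices $C\in\mathbb{R}^{p\times n}$, $D\in\mathbb{R}^{p\times n}$ are given. The data $(U_-,X)$ are informative for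 common $\mathcal{H}_2$ control with performance $\gamma$ if there exist $K\in\mathbb{R}^{m\times n}$, $P\in\mathbb{R}^{n\times n}$ and $Z\in\mathbb{R}^{p\times p}$ such that $\operatorname{trace}Z<\gamma$ and for all $(A,B)\in\Sigma_{(U_-,X)}^R$: $$\begin{bmatrix}P&P(A+BK)&P\\ \star&P&0\\ \star&\star&\gamma I\end{bmatrix}\succ0,\qquad\begin{bmatrix}P&0&C^\top\\ 0&I&D^\top\\ C&D&Z\end{bmatrix}\succ0.$$ *)

theory Defs
  imports "HOL-Analysis.Analysis"
begin

definition hcat :: "'a^'b^'r \<Rightarrow> 'a^'c^'r \<Rightarrow> 'a^('b + 'c)^'r" where
  "hcat A B = (\<chi> i j. case j of Inl k \<Rightarrow> A $ i $ k | Inr k \<Rightarrow> B $ i $ k)"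

definition vcat :: "'a^'c^'r \<Rightarrow> 'a^'c^'s \<Rightarrow> 'a^'c^('r + 's)" where
  "vcat A B = (\<chi> i. case i of Inl k \<Rightarrow> A $ k | Inr k \<Rightarrow> B $ k)"

definition block3 ::
  "real^'a^'r \<Rightarrow> real^'b^'r \<Rightarrow> real^'c^'r \<Rightarrow>
   real^'a^'s \<Rightarrow> real^'b^'s \<Rightarrow> real^'c^'s \<Rightarrow>
   real^'a^'t \<Rightarrow> real^'b^'t \<Rightarrow> real^'c^'t \<Rightarrow> real^('a + 'b + 'c)^('r + 's + 't)" where
  "block3 A11 A12 A13 A21 A22 A23 A31 A32 A33 =
     vcat (hcat A11 (hcat A12 A13)) (vcat (hcat A21 (hcat A22 A23)) (hcat A31 (hcat A32 A33)))"

definition pos_definite :: "real^'k^'k \<Rightarrow> bool" where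
  "pos_definite M \<longleftrightarrow> transpose M = M \<and> (\<forall>v. v \<noteq> 0 \<longrightarrow> v \<bullet> (M *v v) > 0)"

text \<open>
  The data length \<open>N \<ge> 1\<close> is the cardinality of a finite, linearly ordered index type \<open>'N\<close>,
  whose elements are read as the time instants \<open>0, \<dots>, N - 1\<close> in increasing order. Signals are
  functions on all of \<open>nat\<close>, but only \<open>x 0, \<dots>, x N\<close> and \<open>u 0, \<dots>, u (N - 1)\<close> are ever used.
\<close>

definition time :: "'N::{finite,linorder} \<Rightarrow> nat" where
  "time t = card {s. s < t}"

definition data_minus :: "(nat \<Rightarrow> real^'k) \<Rightarrow> real^('N::{finite,linorder})^'k" where
  "data_minus w = (\<chi> i t. w (time t) $ i)"

definition data_plus :: "(nat \<Rightarrow> real^'k) \<Rightarrow> real^('N::{finite,linorder})^'k" where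
  "data_plus w = (\<chi> i t. w (Suc (time t)) $ i)"

text \<open>The order \<open>\<le>\<close> on vectors, hence on matrices, is the entry-wise one.\<close>

definition noise_set :: "real^'N^'M \<Rightarrow> real^'M^'n \<Rightarrow> real^'M^'n \<Rightarrow> (real^'N^'n) set" where
  "noise_set R Cl Cu =
     {E. Cl \<le> (1 / sqrt (real CARD('N))) *\<^sub>R (E ** transpose R) \<and>
         (1 / sqrt (real CARD('N))) *\<^sub>R (E ** transpose R) \<le> Cu}"

definition feasible_systems ::
  "(nat \<Rightarrow> real^'n) \<Rightarrow> (nat \<Rightarrow> real^'m) \<Rightarrow> real^('N::{finite,linorder})^'M \<Rightarrow>
   real^'M^'n \<Rightarrow> real^'M^'n \<Rightarrow> ((real^'n^'n) \<times> (real^'m^'n)) set" where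
  "feasible_systems x u R Cl Cu =
     {(A, B). \<exists>E \<in> noise_set R Cl Cu.
        data_plus x = A ** data_minus x + B ** data_minus u + E}"

definition feasible_matrices ::
  "(nat \<Rightarrow> real^'n) \<Rightarrow> (nat \<Rightarrow> real^'m) \<Rightarrow> real^('N::{finite,linorder})^'M \<Rightarrow>
   real^'M^'n \<Rightarrow> real^'M^'n \<Rightarrow> (real^('n + 'm)^'n) set" where
  "feasible_matrices x u R Cl Cu = (\<lambda>(A, B). hcat A B) ` feasible_systems x u R Cl Cu"

text \<open>\<open>Acl\<close> stands for the closed-loop matrix \<open>A + B K\<close>.\<close>

definition dynamics_matrix :: "real^'n^'n \<Rightarrow> real^'n^'n \<Rightarrow> real \<Rightarrow> real^('n + 'n + 'n)^('n + 'n + 'n)" where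
  "dynamics_matrix P Acl \<gamma> =
     block3 P                        (P ** Acl)      P
            (transpose (P ** Acl))   P               0
            (transpose P)            (transpose 0)   (\<gamma> *\<^sub>R mat 1)"

definition performance_matrix ::
  "real^'n^'n \<Rightarrow> real^'p^'p \<Rightarrow> real^'n^'p \<Rightarrow> real^'n^'p \<Rightarrow> real^('n + 'n + 'p)^('n + 'n + 'p)" where
  "performance_matrix P Z C D =
     block3 P   0         (transpose C)
            0   (mat 1)   (transpose D)
            C   D         Z"

definition informative_common_H2 ::
  "(nat \<Rightarrow> real^'n) \<Rightarrow> (nat \<Rightarrow> real^'m) \<Rightarrow> real^('N::{finite,linorder})^'M \<Rightarrow>
   real^'M^'n \<Rightarrow> real^'M^'n \<Rightarrow> real^'n^'p \<Rightarrow> real^'n^'p \<Rightarrow> real \<Rightarrow> bool" where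
  "informative_common_H2 x u R Cl Cu C D \<gamma> \<longleftrightarrow>
     (\<exists>(K :: real^'n^'m) (P :: real^'n^'n) (Z :: real^'p^'p).
        trace Z < \<gamma> \<and>
        (\<forall>(A, B) \<in> feasible_systems x u R Cl Cu.
           pos_definite (dynamics_matrix P (A + B ** K) \<gamma>) \<and>
           pos_definite (performance_matrix P Z C D)))"

lemma hcat_mult_vcat: "hcat A B ** vcat F G = A ** F + B ** (G :: real^'c^'s)"
  by (simp add: vec_eq_iff matrix_matrix_mult_def hcat_def vcat_def UNIV_Plus_UNIV[symmetric]
      sum.Plus del: UNIV_Plus_UNIV)

lemma hcat_surj: "\<exists>A B. S = hcat A B"
proof (intro exI)
  show "S = hcat (\<chi> i j. S $ i $ Inl j) (\<chi> i j. S $ i $ Inr j)"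
    by (auto simp: hcat_def vec_eq_iff split: sum.split)
qed

lemma hcat_inject: "hcat A B = hcat A' B' \<longleftrightarrow> A = A' \<and> B = B'"
proof
  assume eq: "hcat A B = hcat A' B'"
  have "A $ i $ j = A' $ i $ j" for i j
    using arg_cong[OF eq, of "\<lambda>M. M $ i $ Inl j"] by (simp add: hcat_def)
  moreover have "B $ i $ j = B' $ i $ j" for i j
    using arg_cong[OF eq, of "\<lambda>M. M $ i $ Inr j"] by (simp add: hcat_def)
  ultimately show "A = A' \<and> B = B'"
    by (simp add: vec_eq_iff)
qed simp

lemma matrix_mult_right_linear: "linear (\<lambda>A. A ** (G :: real^'c^'s))"
  by (rule linearI)
    (simp_all add: vec_eq_iff matrix_matrix_mult_def distrib_right sum.distrib sum_distrib_left mult.assoc)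

lemma feasible_matrices_eq:
  fixes x :: "nat \<Rightarrow> real^'n" and u :: "nat \<Rightarrow> real^'m"
    and R :: "real^('N::{finite,linorder})^'M"
  defines "c \<equiv> 1 / sqrt (real CARD('N))"
  defines "Y \<equiv> c *\<^sub>R (data_plus x ** transpose R)"
  defines "G \<equiv> vcat (data_minus x ** transpose R) (data_minus u ** transpose R)"
  shows "feasible_matrices x u R Cl Cu = {S. c *\<^sub>R (S ** G) \<in> cbox (Y - Cu) (Y - Cl)}"
    (is "_ = ?T")
proof -
  have "hcat A B \<in> feasible_matrices x u R Cl Cu \<longleftrightarrow> hcat A B \<in> ?T" for A B
  proof -
    let ?E = "data_plus x - (A ** data_minus x + B ** data_minus u)"
    have "hcat A B \<in> feasible_matrices x u R Cl Cu \<longleftrightarrow> (A, B) \<in> feasible_systems x u R Cl Cu"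
    proof
      assume "hcat A B \<in> feasible_matrices x u R Cl Cu"
      then show "(A, B) \<in> feasible_systems x u R Cl Cu"
        unfolding feasible_matrices_def by (auto simp: hcat_inject)
    next
      assume "(A, B) \<in> feasible_systems x u R Cl Cu"
      then show "hcat A B \<in> feasible_matrices x u R Cl Cu"
        unfolding feasible_matrices_def by (rule rev_image_eqI) simp
    qed
    also have "\<dots> \<longleftrightarrow> (\<exists>E \<in> noise_set R Cl Cu. E = ?E)"
    proof -
      have "data_plus x = A ** data_minus x + B ** data_minus u + E \<longleftrightarrow> E = ?E" for E :: "real^('N::{finite,linorder})^'n"
        by (auto simp: algebra_simps)
      then show ?thesis
        unfolding feasible_systems_def by simp
    qed
    also have "\<dots> \<longleftrightarrow> ?E \<in> noise_set R Cl Cu"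
      by blast
    also have "\<dots> \<longleftrightarrow> c *\<^sub>R (?E ** transpose R) \<in> {Cl..Cu}"
      by (simp add: noise_set_def c_def)
    also have "c *\<^sub>R (?E ** transpose R) = Y - c *\<^sub>R (hcat A B ** G)"
      by (simp add: Y_def G_def hcat_mult_vcat matrix_mul_assoc scaleR_diff_right
          linear_diff[OF matrix_mult_right_linear] linear_add[OF matrix_mult_right_linear])
    also have "\<dots> \<in> {Cl..Cu} \<longleftrightarrow> c *\<^sub>R (hcat A B ** G) \<in> {Y - Cu..Y - Cl}"
      by (simp add: le_diff_eq diff_le_eq less_eq_vec_def add.commute conj_commute)
    also have "{Y - Cu..Y - Cl} = cbox (Y - Cu) (Y - Cl)"
      by (auto simp: less_eq_vec_def mem_box Basis_vec_def inner_axis)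
    finally show ?thesis
      by simp
  qed
  then show ?thesis
    by (intro set_eqI) (metis hcat_surj)
qed

lemma polytope_feasible_matrices:
  fixes x :: "nat \<Rightarrow> real^'n" and u :: "nat \<Rightarrow> real^'m"
    and R :: "real^('N::{finite,linorder})^'M"
  assumes ker: "{v. transpose (vcat (data_minus x ** transpose R) (data_minus u ** transpose R)) *v v = 0} = {0}"
  shows "polytope (feasible_matrices x u R Cl Cu)"
proof -
  define c where "c = 1 / sqrt (real CARD('N))"
  define Y where "Y = c *\<^sub>R (data_plus x ** transpose R)"
  define G where "G = vcat (data_minus x ** transpose R) (data_minus u ** transpose R)"
  define f :: "real^('n + 'm)^'n \<Rightarrow> real^'M^'n" where "f = (\<lambda>S. c *\<^sub>R (S ** G))"
  have c: "c \<noteq> 0"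
    by (simp add: c_def)
  have lin: "linear f"
    unfolding f_def by (intro linear_compose_scale_right matrix_mult_right_linear)
  have "S = 0" if "f S = 0" for S
  proof -
    have 0: "S ** G = 0"
      using that c by (simp add: f_def)
    have "transpose G *v (S $ i) = 0" for i
    proof -
      have "transpose G *v (S $ i) = S $ i v* G"
        by simp
      also have "\<dots> = (S ** G) $ i"
        by (simp add: vec_eq_iff matrix_matrix_mult_def vector_matrix_mult_def mult.commute)
      finally show ?thesis
        using 0 by simp
    qed
    then have "S $ i = 0" for i
      using ker unfolding G_def by blast
    then show ?thesis
      by (simp add: vec_eq_iff)
  qed
  then have "inj f"
    using lin by (simp add: linear_injective_0)
  then obtain g where g: "linear g" "g \<circ> f = id"
    using lin linear_injective_left_inverse by blast
  have "feasible_matrices x u R Cl Cu = {S. f S \<in> cbox (Y - Cu) (Y - Cl)}"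
    unfolding f_def Y_def c_def G_def by (rule feasible_matrices_eq)
  moreover have "{S. f S \<in> T} = g ` (T \<inter> range f)" for T
  proof -
    have gf: "g (f S) = S" for S
      using g(2) by (simp add: fun_eq_iff)
    have "f ` {S. f S \<in> T} = T \<inter> range f"
      by blast
    then have "g ` (T \<inter> range f) = g ` f ` {S. f S \<in> T}"
      by (rule arg_cong[where f = "(`) g", symmetric])
    also have "\<dots> = {S. f S \<in> T}"
      by (simp add: image_image gf)
    finally show ?thesis
      by (rule sym)
  qed
  ultimately have eq: "feasible_matrices x u R Cl Cu = g ` (cbox (Y - Cu) (Y - Cl) \<inter> range f)"
    by (rule trans)
  have "polyhedron (range f)"
    by (intro affine_imp_polyhedron subspace_imp_affine linear_subspace_image lin subspace_UNIV)
  then show ?thesis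
    unfolding eq by (intro polytope_linear_image g polytope_Int_polyhedron polytope_interval)
qed

text \<open>
  Under the kernel condition, an enumeration of the vertices always exists and their convex hull is
  the whole set.
\<close>

corollary vertex_enumeration_feasible_matrices:
  fixes x :: "nat \<Rightarrow> real^'n" and u :: "nat \<Rightarrow> real^'m"
    and R :: "real^('N::{finite,linorder})^'M"
  assumes "{v. transpose (vcat (data_minus x ** transpose R) (data_minus u ** transpose R)) *v v = 0} = {0}"
  obtains L \<sigma> where "bij_betw \<sigma> {1..L::nat} {V. V extreme_point_of feasible_matrices x u R Cl Cu}"
    and "feasible_matrices x u R Cl Cu = convex hull (\<sigma> ` {1..L})"
proof -
  let ?S = "feasible_matrices x u R Cl Cu"
  have poly: "polytope ?S"
    by (rule polytope_feasible_matrices[OF assms])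
  then have "finite {V. V extreme_point_of ?S}"
    by (simp add: finite_polyhedron_extreme_points polytope_imp_polyhedron)
  then obtain \<sigma> where \<sigma>: "bij_betw \<sigma> {1..card {V. V extreme_point_of ?S}} {V. V extreme_point_of ?S}"
    using ex_bij_betw_nat_finite_1 by blast
  have "?S = convex hull {V. V extreme_point_of ?S}"
    by (intro Krein_Milman_Minkowski polytope_imp_compact polytope_imp_convex poly)
  also have "{V. V extreme_point_of ?S} = \<sigma> ` {1..card {V. V extreme_point_of ?S}}"
    by (rule bij_betw_imp_surj_on[OF \<sigma>, symmetric])
  finally show thesis
    using that \<sigma> by blast
qed

end

theory Submission
  imports Defs
begin

text \<open>
  Fix \<open>K\<close>, \<open>P\<close> and \<open>Z\<close>. The closed-loop matrix \<open>A + B K\<close> is the product of \<open>[A B]\<close> with \<open>[I; K]\<close>,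
  so it is linear in \<open>[A B]\<close>, and the dynamics matrix is affine in it. Positive definite matrices
  form a convex set (\<open>convex_pos_definite\<close>), and hence so do the systems \<open>[A B]\<close> that satisfy the
  dynamics inequality (\<open>convex_dynamics_pos_definite\<close>). Under the kernel condition, the feasible
  systems are a polytope, the convex hull of its vertices: a convex set contains all of it as soon as
  it contains the vertices. The performance inequality does not involve \<open>(A, B)\<close> at all. It only
  has to be carried over from one index set to the other, which works because every feasible system
  forces the existence of a vertex, and every vertex is a feasible system.
\<close>

lemma convex_pos_definite: "convex {M :: real^'k^'k. pos_definite M}"
proof (rule convexI)
  fix M N :: "real^'k^'k" and s t :: real
  assume MN: "M \<in> {M. pos_definite M}" "N \<in> {M. pos_definite M}" and st: "0 \<le> s" "0 \<le> t" "s + t = 1"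
  have "v \<bullet> ((s *\<^sub>R M + t *\<^sub>R N) *v v) > 0" if "v \<noteq> 0" for v
  proof -
    have "s *\<^sub>R (v \<bullet> (M *v v)) + t *\<^sub>R (v \<bullet> (N *v v)) \<in> {0<..}"
      using MN st that by (intro convexD convex_real_interval) (auto simp: pos_definite_def)
    then show ?thesis
      by (simp add: matrix_vector_mult_add_rdistrib scaleR_matrix_vector_assoc[symmetric] inner_add_right)
  qed
  moreover have "transpose (s *\<^sub>R M + t *\<^sub>R N) = s *\<^sub>R transpose M + t *\<^sub>R transpose N"
    by (simp add: vec_eq_iff transpose_def)
  ultimately show "s *\<^sub>R M + t *\<^sub>R N \<in> {M. pos_definite M}"
    using MN by (simp add: pos_definite_def)
qed

lemma block3_convex_combination:
  "block3 (s *\<^sub>R A11 + t *\<^sub>R B11) (s *\<^sub>R A12 + t *\<^sub>R B12) (s *\<^sub>R A13 + t *\<^sub>R B13)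
     (s *\<^sub>R A21 + t *\<^sub>R B21) (s *\<^sub>R A22 + t *\<^sub>R B22) (s *\<^sub>R A23 + t *\<^sub>R B23)
     (s *\<^sub>R A31 + t *\<^sub>R B31) (s *\<^sub>R A32 + t *\<^sub>R B32) (s *\<^sub>R A33 + t *\<^sub>R B33) =
   s *\<^sub>R block3 A11 A12 A13 A21 A22 A23 A31 A32 A33 + t *\<^sub>R block3 B11 B12 B13 B21 B22 B23 B31 B32 B33"
  by (simp add: vec_eq_iff block3_def vcat_def hcat_def split: sum.split)

text \<open>
  The dependence on the closed-loop matrix is affine rather than linear because of the constant
  blocks \<open>P\<close> and \<open>\<gamma> I\<close>: a combination preserves them when its weights sum to one.
\<close>

lemma dynamics_matrix_affine:
  fixes P F G :: "real^'n^'n"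
  assumes "s + t = 1"
  shows "dynamics_matrix P (s *\<^sub>R F + t *\<^sub>R G) \<gamma> =
    s *\<^sub>R dynamics_matrix P F \<gamma> + t *\<^sub>R dynamics_matrix P G \<gamma>"
proof -
  have product: "P ** (s *\<^sub>R F + t *\<^sub>R G) = s *\<^sub>R (P ** F) + t *\<^sub>R (P ** G)"
    by (simp add: vec_eq_iff matrix_matrix_mult_def algebra_simps sum.distrib sum_distrib_left)
  then have "transpose (P ** (s *\<^sub>R F + t *\<^sub>R G)) = s *\<^sub>R transpose (P ** F) + t *\<^sub>R transpose (P ** G)"
    by (simp add: vec_eq_iff transpose_def)
  moreover have "s *\<^sub>R W + t *\<^sub>R W = W" for W :: "real^'n^'n"
    using assms by (simp add: scaleR_add_left[symmetric])
  ultimately show ?thesis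
    unfolding dynamics_matrix_def block3_convex_combination[symmetric] product
    by (simp del: scaleR_scaleR)
qed

lemma convex_dynamics_pos_definite:
  "convex {S :: real^'k^'n. pos_definite (dynamics_matrix P (S ** G) \<gamma>)}"
proof -
  have "convex {F. pos_definite (dynamics_matrix P F \<gamma>)}"
    using convexD[OF convex_pos_definite]
    by (intro convexI) (simp add: dynamics_matrix_affine)
  then have "convex ((\<lambda>S :: real^'k^'n. S ** G) -` {F. pos_definite (dynamics_matrix P F \<gamma>)})"
    by (rule convex_linear_vimage[OF matrix_mult_right_linear])
  then show ?thesis
    by (simp add: vimage_def)
qed

text \<open>
  A condition on \<open>A + B K\<close> becomes one on \<open>S = [A B]\<close>, in which the closed-loop matrix is linear; in
  this form it can be compared with its restriction to the vertices.
\<close>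

lemma ball_feasible_systems_iff:
  "(\<forall>(A, B) \<in> feasible_systems x u R Cl Cu. Q (A + B ** K)) \<longleftrightarrow>
   (\<forall>S \<in> feasible_matrices x u R Cl Cu. Q (S ** vcat (mat 1) K))"
  by (auto simp: feasible_matrices_def hcat_mult_vcat split: prod.splits)

theorem proposition24:
  fixes x :: "nat \<Rightarrow> real^'n" and u :: "nat \<Rightarrow> real^'m"
    and R :: "real^('N::{finite,linorder})^'M"
    and Cl Cu :: "real^'M^'n"
    and A0 :: "real^'n^'n" and B0 :: "real^'m^'n" and E0 :: "real^('N::{finite,linorder})^'n"
    and C D :: "real^'n^'p"
    and \<sigma> :: "nat \<Rightarrow> real^('n + 'm)^'n" and L :: nat
    and \<gamma> :: real
  assumes true_noise: "E0 \<in> noise_set R Cl Cu"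
    and true_system: "data_plus x = A0 ** data_minus x + B0 ** data_minus u + E0"
    and kernel: "{v. transpose (vcat (data_minus x ** transpose R) (data_minus u ** transpose R)) *v v = 0} = {0}"
    and vertices: "bij_betw \<sigma> {1..L} {V. V extreme_point_of feasible_matrices x u R Cl Cu}"
    and "\<gamma> > 0"
  shows "informative_common_H2 x u R Cl Cu C D \<gamma> \<longleftrightarrow>
    (\<exists>(K :: real^'n^'m) (P :: real^'n^'n) (Z :: real^'p^'p).
       trace Z < \<gamma> \<and>
       (\<forall>i\<in>{1..L}.
          pos_definite (performance_matrix P Z C D) \<and>
          pos_definite (dynamics_matrix P (\<sigma> i ** vcat (mat 1) K) \<gamma>)))"
proof -
  let ?F = "feasible_matrices x u R Cl Cu"
  have poly: "polytope ?F"
    by (rule polytope_feasible_matrices[OF kernel])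
  have "?F = convex hull {V. V extreme_point_of ?F}"
    by (intro Krein_Milman_Minkowski polytope_imp_compact polytope_imp_convex poly)
  also have "{V. V extreme_point_of ?F} = \<sigma> ` {1..L}"
    by (rule bij_betw_imp_surj_on[OF vertices, symmetric])
  finally have hull: "?F = convex hull (\<sigma> ` {1..L})" .
  have "(\<forall>(A, B) \<in> feasible_systems x u R Cl Cu.
          pos_definite (dynamics_matrix P (A + B ** K) \<gamma>) \<and> pos_definite (performance_matrix P Z C D)) \<longleftrightarrow>
        (\<forall>i\<in>{1..L}. pos_definite (performance_matrix P Z C D) \<and>
          pos_definite (dynamics_matrix P (\<sigma> i ** vcat (mat 1) K) \<gamma>))"
    for P :: "real^'n^'n" and K :: "real^'n^'m" and Z :: "real^'p^'p"
  proof -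
    let ?good = "{S. pos_definite (dynamics_matrix P (S ** vcat (mat 1) K) \<gamma>)}"
    have "?F \<subseteq> ?good \<longleftrightarrow> \<sigma> ` {1..L} \<subseteq> ?good"
      unfolding hull by (rule subset_hull) (rule convex_dynamics_pos_definite)
    moreover have "?F = {} \<longleftrightarrow> {1..L} = {}"
      unfolding hull by simp
    ultimately show ?thesis
      unfolding ball_feasible_systems_iff[where Q = "\<lambda>F. pos_definite (dynamics_matrix P F \<gamma>) \<and> _"]
      by blast
  qed
  then show ?thesis
    unfolding informative_common_H2_def by simp
qed

end
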